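(* Let $\mathcal{B}=(X,P,B)$ be an unbounded ballean. Then the following statements hold: (i) the hyperballean $\mathcal{B}^{\flat}$ is uniformly locally finite if and only if $\mathcal{B}=\mathbf{F}_{X}$; (ii) the hyperballean $\mathcal{B}^{\flat}$ is of bounded geometry if and only if there exists a large subset $Y$ of $X$ such that $\mathcal{B}_{Y}=\mathbf{F}_{Y}$. Here the equality of two balleans with the same support means that the identity mapping of the support is an asymorphism between them.
   Context: A ball structure is a triple $\mathcal{B}=(X,P,B)$, where $X,P$ are non-empty sets and, for all $x\in X$ and $\alpha\in P$, $B(x,\alpha)$ is a subset of $X$ with $x\in B(x,\alpha)$, called the ball of radius $\alpha$ around $x$. The set $X$ is the support of $\mathcal{B}$ and $P$ is the set of radii. For $x\in X$, $A\subseteq X$, $\alpha\in P$ put $B^{*}(x,\alpha)=\{y\in X: x\in B(y,\alpha)\}$ and $B(A,\alpha)=\bigcup_{a\in A}B(a,\alpha)$. A ball structure $\mathcal{B}=(X,P,B)$ is a ballean if: (1) for any $\alpha,\beta\in P$ there exist $\alpha',\beta'\in P$ such that for every $x\in X$, $B(x,\alpha)\subseteq B^{*}(x,\alpha')$ and $B^{*}(x,\beta)\subseteq B(x,\beta')$; (2) for any $\alpha,\beta\in P$ there exists $\gamma\in P$ such that for every $x\in X$, $B(B(x,\alpha),\beta)\subseteq B(x,\gamma)$; (3) for any $x,y\in X$ there exists $\alpha\in P$ such that $y\in B(x,\alpha)$. Standing convention: all balleans are assumed symmetric, i.e. $B(x,\alpha)=B^{*}(x,\alpha)$ for all $x\in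 X$, $\alpha\in P$. For balleans $\mathcal{B}=(X,P,B)$ and $\mathcal{B}'=(X',P',B')$, a mapping $f:X\to X'$ is coarse if for every $\alpha\in P$ there exists $\alpha'\in P'$ such that $f(B(x,\alpha))\subseteq B'(f(x),\alpha')$ for every $x\in X$. A bijection $f:X\to X'$ is an asymorphism if $f$ and $f^{-1}$ are coarse. If $X=X'$ and the identity mapping is an asymorphism, one writes $\mathcal{B}=\mathcal{B}'$. For a non-empty subset $Y\subseteq X$, the subballean $\mathcal{B}_{Y}$ is $(Y,P,B_{Y})$ with $B_{Y}(y,\alpha)=Y\cap B(y,\alpha)$. A subset $Y\subseteq X$ is large if $X=B(Y,\alpha)$ for some $\alpha\in P$. A subset $Y\subseteq X$ is bounded if there exist $x\in X$ and $\alpha\in P$ with $Y\subseteq B(x,\alpha)$. A ballean is bounded if its support is bounded, and unbounded otherwise. Hyperballean: $X^{\flat}$ is the family of all non-empty bounded subsets of $X$, and $\mathcal{B}^{\flat}=(X^{\flat},P,B^{\flat})$, where $B^{\flat}(Y,\alpha)=\{Z\in X^{\flat}: Z\subseteq B(Y,\alpha),\ Y\subseteq B(Z,\alpha)\}$. For $\alpha\in P$, a subset $S\subseteq X$ is $\alpha$-discrete if $B(x,\alpha)\cap S=\{x\}$ for each $x\in S$. A ballean $\mathcal{B}=(X,P,B)$ is of bounded geometry if there exist $\alpha\in P$ and a function $f:P\to\mathbb{N}$ such that, whenever $S$ is an $\alpha$-discrete subset of a ball $B(x,\beta)$ (with $x\in X$, $\beta\in P$), then $|S|\le f(\beta)$.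 A ballean $\mathcal{B}$ is uniformly locally finite if for every $\beta\in P$ there is $n(\beta)\in\mathbb{N}$ such that $|B(x,\beta)|\le n(\beta)$ for every $x\in X$. For a non-empty set $X$, let $\mathcal{F}_{X}$ be the family of all finite subsets of $X$. Then $\mathbf{F}_{X}$ denotes the ballean $(X,\mathcal{F}_{X},B_{\mathbf{F}})$, where $B_{\mathbf{F}}(x,F)=\{x\}$ if $x\notin F$ and $B_{\mathbf{F}}(x,F)=F$ if $x\in F$. *)

theory Defs
  imports Main
begin

text \<open>
  Only points of the support and radii in \<open>radii\<close> are meaningful; the values of \<open>ball_at\<close>
  at other arguments are never used.
\<close>

record ('x, 'p) ball_struct =
  supp :: "'x set"
  radii :: "'p set"
  ball_at :: "'x \<Rightarrow> 'p \<Rightarrow> 'x set"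

definition ball_structure :: "('x, 'p) ball_struct \<Rightarrow> bool" where
  "ball_structure B \<longleftrightarrow> supp B \<noteq> {} \<and> radii B \<noteq> {} \<and>
     (\<forall>x\<in>supp B. \<forall>\<alpha>\<in>radii B. ball_at B x \<alpha> \<subseteq> supp B \<and> x \<in> ball_at B x \<alpha>)"

definition dual_ball_at :: "('x, 'p) ball_struct \<Rightarrow> 'x \<Rightarrow> 'p \<Rightarrow> 'x set" where
  "dual_ball_at B x \<alpha> = {y \<in> supp B. x \<in> ball_at B y \<alpha>}"

definition ball_around :: "('x, 'p) ball_struct \<Rightarrow> 'x set \<Rightarrow> 'p \<Rightarrow> 'x set" where
  "ball_around B A \<alpha> = (\<Union>a\<in>A. ball_at B a \<alpha>)"

definition symmetric_ball_structure :: "('x, 'p) ball_struct \<Rightarrow> bool" where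
  "symmetric_ball_structure B \<longleftrightarrow>
     (\<forall>x\<in>supp B. \<forall>\<alpha>\<in>radii B. ball_at B x \<alpha> = dual_ball_at B x \<alpha>)"

text \<open>As is customary, balleans are assumed to be symmetric; this is the last conjunct.\<close>

definition ballean :: "('x, 'p) ball_struct \<Rightarrow> bool" where
  "ballean B \<longleftrightarrow> ball_structure B \<and>
     (\<forall>\<alpha>\<in>radii B. \<forall>\<beta>\<in>radii B. \<exists>\<alpha>'\<in>radii B. \<exists>\<beta>'\<in>radii B. \<forall>x\<in>supp B.
        ball_at B x \<alpha> \<subseteq> dual_ball_at B x \<alpha>' \<and> dual_ball_at B x \<beta> \<subseteq> ball_at B x \<beta>') \<and>
     (\<forall>\<alpha>\<in>radii B. \<forall>\<beta>\<in>radii B. \<exists>\<gamma>\<in>radii B. \<forall>x\<in>supp B.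
        ball_around B (ball_at B x \<alpha>) \<beta> \<subseteq> ball_at B x \<gamma>) \<and>
     (\<forall>x\<in>supp B. \<forall>y\<in>supp B. \<exists>\<alpha>\<in>radii B. y \<in> ball_at B x \<alpha>) \<and>
     symmetric_ball_structure B"

definition coarse_map ::
  "('x, 'p) ball_struct \<Rightarrow> ('y, 'q) ball_struct \<Rightarrow> ('x \<Rightarrow> 'y) \<Rightarrow> bool" where
  "coarse_map B B' f \<longleftrightarrow> f ` supp B \<subseteq> supp B' \<and>
     (\<forall>\<alpha>\<in>radii B. \<exists>\<alpha>'\<in>radii B'. \<forall>x\<in>supp B. f ` ball_at B x \<alpha> \<subseteq> ball_at B' (f x) \<alpha>')"

definition asymorphism ::
  "('x, 'p) ball_struct \<Rightarrow> ('y, 'q) ball_struct \<Rightarrow> ('x \<Rightarrow> 'y) \<Rightarrow> bool" where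
  "asymorphism B B' f \<longleftrightarrow> bij_betw f (supp B) (supp B') \<and>
     coarse_map B B' f \<and> coarse_map B' B (inv_into (supp B) f)"

text \<open>
  Equality of balleans in the coarse sense (written \<open>=\<close> in the literature): same support, and the
  identity is an asymorphism. The sets of radii may be unrelated, even of different types.
\<close>

definition ballean_eq ::
  "('x, 'p) ball_struct \<Rightarrow> ('x, 'q) ball_struct \<Rightarrow> bool" where
  "ballean_eq B B' \<longleftrightarrow> supp B = supp B' \<and> asymorphism B B' id"

definition subballean :: "('x, 'p) ball_struct \<Rightarrow> 'x set \<Rightarrow> ('x, 'p) ball_struct" where
  "subballean B Y =
     \<lparr>supp = Y, radii = radii B, ball_at = (\<lambda>y \<alpha>. Y \<inter> ball_at B y \<alpha>)\<rparr>"

definition large_in :: "('x, 'p) ball_struct \<Rightarrow> 'x set \<Rightarrow> bool" where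
  "large_in B Y \<longleftrightarrow> Y \<subseteq> supp B \<and> (\<exists>\<alpha>\<in>radii B. supp B = ball_around B Y \<alpha>)"

definition bounded_in :: "('x, 'p) ball_struct \<Rightarrow> 'x set \<Rightarrow> bool" where
  "bounded_in B Y \<longleftrightarrow>
     Y \<subseteq> supp B \<and> (\<exists>x\<in>supp B. \<exists>\<alpha>\<in>radii B. Y \<subseteq> ball_at B x \<alpha>)"

definition bounded_ballean :: "('x, 'p) ball_struct \<Rightarrow> bool" where
  "bounded_ballean B \<longleftrightarrow> bounded_in B (supp B)"

definition hyper_supp :: "('x, 'p) ball_struct \<Rightarrow> 'x set set" where
  "hyper_supp B = {Y. Y \<noteq> {} \<and> bounded_in B Y}"

definition hyperballean :: "('x, 'p) ball_struct \<Rightarrow> ('x set, 'p) ball_struct" where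
  "hyperballean B =
     \<lparr>supp = hyper_supp B, radii = radii B,
      ball_at = (\<lambda>Y \<alpha>. {Z \<in> hyper_supp B. Z \<subseteq> ball_around B Y \<alpha> \<and> Y \<subseteq> ball_around B Z \<alpha>})\<rparr>"

definition discrete_in :: "('x, 'p) ball_struct \<Rightarrow> 'p \<Rightarrow> 'x set \<Rightarrow> bool" where
  "discrete_in B \<alpha> S \<longleftrightarrow> S \<subseteq> supp B \<and> (\<forall>x\<in>S. ball_at B x \<alpha> \<inter> S = {x})"

text \<open>
  In the next two definitions finiteness is required explicitly, since \<open>card\<close> is \<open>0\<close> on
  infinite sets.
\<close>

definition bounded_geometry :: "('x, 'p) ball_struct \<Rightarrow> bool" where
  "bounded_geometry B \<longleftrightarrow>
     (\<exists>\<alpha>\<in>radii B. \<exists>f :: 'p \<Rightarrow> nat. \<forall>x\<in>supp B. \<forall>\<beta>\<in>radii B. \<forall>S.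
        discrete_in B \<alpha> S \<and> S \<subseteq> ball_at B x \<beta> \<longrightarrow> finite S \<and> card S \<le> f \<beta>)"

definition uniformly_locally_finite :: "('x, 'p) ball_struct \<Rightarrow> bool" where
  "uniformly_locally_finite B \<longleftrightarrow>
     (\<forall>\<beta>\<in>radii B. \<exists>n :: nat. \<forall>x\<in>supp B. finite (ball_at B x \<beta>) \<and> card (ball_at B x \<beta>) \<le> n)"

definition finitary_ballean :: "'x set \<Rightarrow> ('x, 'x set) ball_struct" where
  "finitary_ballean X =
     \<lparr>supp = X, radii = {F. F \<subseteq> X \<and> finite F},
      ball_at = (\<lambda>x F. if x \<in> F then F else {x})\<rparr>"

end

theory Submission
  imports Defs
begin

text \<open>
  Restricted to subsets of \<open>Y\<close>, the hyperballean has uniformly finite balls if and only if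
  \<open>\<B>\<^sub>Y = \<^bold>F\<^sub>Y\<close>. In one direction, a set in the ball around \<open>W\<close> differs from \<open>W\<close> only inside a fixed
  finite set. In the other, if \<open>x\<^sub>1, \<dots>, x\<^sub>k \<in> Y\<close> have companions \<open>y\<^sub>i \<noteq> x\<^sub>i\<close> in \<open>Y\<close> within distance
  \<open>\<beta>\<close>, then the \<open>k\<close> sets \<open>W - {x\<^sub>i}\<close> all lie in the \<open>\<beta>\<close>-ball around \<open>W = {x\<^sub>1, \<dots>, x\<^sub>k, y\<^sub>1, \<dots>, y\<^sub>k}\<close>.

  For \<open>Y = X\<close> this is (i). For (ii), the subsets of an \<open>\<alpha>\<close>-discrete set form an \<open>\<alpha>\<close>-discrete family,
  so bounded geometry applies to a maximal \<open>\<alpha>\<close>-discrete set \<open>Y\<close>, which is large; conversely, a bounded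
  set is approximated by its neighbourhood in a large set \<open>Y\<close>.
\<close>

section \<open>Balls, neighbourhoods of sets and bounded sets\<close>

lemma ballean_memD:
  assumes "ballean B" "x \<in> supp B" "\<alpha> \<in> radii B"
  shows ball_at_subset: "ball_at B x \<alpha> \<subseteq> supp B"
    and ball_at_center: "x \<in> ball_at B x \<alpha>"
  using assms unfolding ballean_def ball_structure_def by auto

lemma ball_at_commute:
  assumes "ballean B" "\<alpha> \<in> radii B" "x \<in> supp B" "y \<in> supp B"
  shows "y \<in> ball_at B x \<alpha> \<longleftrightarrow> x \<in> ball_at B y \<alpha>"
proof -
  have "ball_at B x \<alpha> = dual_ball_at B x \<alpha>"
    using assms unfolding ballean_def symmetric_ball_structure_def by blast
  then show ?thesis
    using assms(4) by (auto simp: dual_ball_at_def)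
qed

text \<open>The second axiom speaks of a single centre; taking unions over \<open>A\<close> gives it
  for sets. Hyperballs are defined through \<open>ball_around\<close>, so this is the form in which
  distances between sets are added up.\<close>

lemma ballean_compose:
  assumes "ballean B" "\<alpha> \<in> radii B" "\<beta> \<in> radii B"
  obtains \<gamma> where "\<gamma> \<in> radii B"
    "\<And>A. A \<subseteq> supp B \<Longrightarrow> ball_around B (ball_around B A \<alpha>) \<beta> \<subseteq> ball_around B A \<gamma>"
proof -
  have "\<forall>\<alpha>\<in>radii B. \<forall>\<beta>\<in>radii B. \<exists>\<gamma>\<in>radii B. \<forall>x\<in>supp B.
      ball_around B (ball_at B x \<alpha>) \<beta> \<subseteq> ball_at B x \<gamma>"
    using assms(1) unfolding ballean_def by (elim conjE)
  then obtain \<gamma> where "\<gamma> \<in> radii B"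
    "\<forall>x\<in>supp B. ball_around B (ball_at B x \<alpha>) \<beta> \<subseteq> ball_at B x \<gamma>"
    using assms(2,3) by blast
  then show thesis
    by (intro that) (force simp: ball_around_def)+
qed

lemma ball_around_singleton [simp]: "ball_around B {x} \<alpha> = ball_at B x \<alpha>"
  by (simp add: ball_around_def)

lemma ball_around_mono: "A \<subseteq> C \<Longrightarrow> ball_around B A \<alpha> \<subseteq> ball_around B C \<alpha>"
  by (auto simp: ball_around_def)

lemma ball_around_superset:
  assumes "ballean B" "A \<subseteq> supp B" "\<alpha> \<in> radii B"
  shows "A \<subseteq> ball_around B A \<alpha>"
  using assms ball_at_center unfolding ball_around_def by fast

lemma ball_around_subset:
  assumes "ballean B" "A \<subseteq> supp B" "\<alpha> \<in> radii B"
  shows "ball_around B A \<alpha> \<subseteq> supp B"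
  using assms ball_at_subset unfolding ball_around_def by fast

lemma bounded_in_ball_around:
  assumes "ballean B" "bounded_in B A" "\<alpha> \<in> radii B"
  shows "bounded_in B (ball_around B A \<alpha>)"
proof -
  obtain x \<beta> where x: "x \<in> supp B" "\<beta> \<in> radii B" "A \<subseteq> ball_at B x \<beta>" and A: "A \<subseteq> supp B"
    using assms(2) unfolding bounded_in_def by blast
  obtain \<gamma> where \<gamma>: "\<gamma> \<in> radii B"
    "\<And>A. A \<subseteq> supp B \<Longrightarrow> ball_around B (ball_around B A \<beta>) \<alpha> \<subseteq> ball_around B A \<gamma>"
    using ballean_compose assms(1,3) x(2) by metis
  have "ball_around B A \<alpha> \<subseteq> ball_at B x \<gamma>"
    using \<gamma>(2)[of "{x}"] ball_around_mono[OF x(3)] x(1) by fastforce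
  then show ?thesis
    using ball_around_subset[OF assms(1) A assms(3)] x(1) \<gamma>(1) unfolding bounded_in_def by blast
qed

lemma bounded_in_subset: "bounded_in B A \<Longrightarrow> C \<subseteq> A \<Longrightarrow> bounded_in B C"
  unfolding bounded_in_def by blast

text \<open>The third axiom reaches each single point from \<open>x\<close>; composing radii absorbs
  the points one at a time.\<close>

lemma finite_subset_ball_at:
  assumes "ballean B" "finite A" "A \<subseteq> supp B" "x \<in> supp B"
  shows "\<exists>\<alpha>\<in>radii B. A \<subseteq> ball_at B x \<alpha>"
  using assms(2,3)
proof (induction A rule: finite_induct)
  case empty
  then show ?case
    using assms(1) by (auto simp: ballean_def ball_structure_def)
next
  case (insert a A)
  then obtain \<alpha> where \<alpha>: "\<alpha> \<in> radii B" "A \<subseteq> ball_at B x \<alpha>"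
    by auto
  have "\<forall>x\<in>supp B. \<forall>y\<in>supp B. \<exists>\<alpha>\<in>radii B. y \<in> ball_at B x \<alpha>"
    using assms(1) unfolding ballean_def by (elim conjE)
  then obtain \<beta> where \<beta>: "\<beta> \<in> radii B" "a \<in> ball_at B x \<beta>"
    using assms(4) insert.prems by blast
  obtain \<gamma> where \<gamma>: "\<gamma> \<in> radii B"
    "\<And>A. A \<subseteq> supp B \<Longrightarrow> ball_around B (ball_around B A \<alpha>) \<beta> \<subseteq> ball_around B A \<gamma>"
    using ballean_compose assms(1) \<alpha>(1) \<beta>(1) by metis
  have *: "ball_around B (ball_at B x \<alpha>) \<beta> \<subseteq> ball_at B x \<gamma>"
    using \<gamma>(2)[of "{x}"] assms(4) by simp
  have "a \<in> ball_around B (ball_at B x \<alpha>) \<beta>"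
    using \<beta>(2) ball_at_center[OF assms(1,4) \<alpha>(1)] unfolding ball_around_def by blast
  moreover have "A \<subseteq> ball_around B (ball_at B x \<alpha>) \<beta>"
    using \<alpha>(2) ball_around_superset[OF assms(1) ball_at_subset[OF assms(1,4) \<alpha>(1)] \<beta>(1)] by blast
  ultimately show ?case
    using * \<gamma>(1) by blast
qed

lemma finite_bounded_in:
  assumes "ballean B" "finite A" "A \<subseteq> supp B"
  shows "bounded_in B A"
proof -
  obtain x where "x \<in> supp B"
    using assms(1) by (auto simp: ballean_def ball_structure_def)
  then show ?thesis
    using finite_subset_ball_at[OF assms] assms(3) unfolding bounded_in_def by blast
qed

section \<open>Membership in hyperballs, and comparison with the finitary ballean\<close>

lemma mem_hyper_ball_iff:
  "Z \<in> ball_at (hyperballean B) W \<beta> \<longleftrightarrow>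
     Z \<in> hyper_supp B \<and> Z \<subseteq> ball_around B W \<beta> \<and> W \<subseteq> ball_around B Z \<beta>"
  by (simp add: hyperballean_def)

lemma hyperballean_simps [simp]:
  "supp (hyperballean B) = hyper_supp B" "radii (hyperballean B) = radii B"
  by (simp_all add: hyperballean_def)

text \<open>Balls of the finitary ballean are singletons or the fixed set \<open>F\<close>, so it
  suffices to find one radius that covers \<open>F\<close> from each of its points: go to a base
  point of \<open>F\<close>, then out again.\<close>

lemma coarse_map_finitary_ballean:
  assumes "ballean B" "Y \<subseteq> supp B"
  shows "coarse_map (finitary_ballean Y) (subballean B Y) id"
proof -
  have "\<exists>\<alpha>\<in>radii B. \<forall>x\<in>Y. (if x \<in> F then F else {x}) \<subseteq> Y \<inter> ball_at B x \<alpha>"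
    if F: "F \<subseteq> Y" "finite F" for F
  proof (cases "F = {}")
    case True
    obtain \<alpha> where "\<alpha> \<in> radii B"
      using assms(1) by (auto simp: ballean_def ball_structure_def)
    with True show ?thesis
      using ball_at_center[OF assms(1)] assms(2) by (intro bexI[of _ \<alpha>]) auto
  next
    case False
    then obtain x\<^sub>0 where x\<^sub>0: "x\<^sub>0 \<in> F" "x\<^sub>0 \<in> supp B"
      using F assms(2) by blast
    obtain \<alpha> where \<alpha>: "\<alpha> \<in> radii B" "F \<subseteq> ball_at B x\<^sub>0 \<alpha>"
      using finite_subset_ball_at[OF assms(1) F(2) _ x\<^sub>0(2)] F(1) assms(2) by blast
    obtain \<gamma> where \<gamma>: "\<gamma> \<in> radii B"
      "\<And>A. A \<subseteq> supp B \<Longrightarrow> ball_around B (ball_around B A \<alpha>) \<alpha> \<subseteq> ball_around B A \<gamma>"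
      using ballean_compose assms(1) \<alpha>(1) by metis
    have "F \<subseteq> ball_at B x \<gamma>" if x: "x \<in> F" for x
    proof -
      have xs: "x \<in> supp B"
        using x F(1) assms(2) by blast
      then have "x\<^sub>0 \<in> ball_at B x \<alpha>"
        using ball_at_commute[OF assms(1) \<alpha>(1) x\<^sub>0(2)] x \<alpha>(2) by blast
      then have "F \<subseteq> ball_around B (ball_at B x \<alpha>) \<alpha>"
        using \<alpha>(2) unfolding ball_around_def by blast
      then show ?thesis
        using \<gamma>(2)[of "{x}"] xs by auto
    qed
    then show ?thesis
      using \<gamma>(1) ball_at_center[OF assms(1) _ \<gamma>(1)] F(1) assms(2)
      by (intro bexI[of _ \<gamma>]) auto
  qed
  then show ?thesis
    by (simp add: coarse_map_def finitary_ballean_def subballean_def split del: if_split)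
qed

text \<open>\<open>asymorphism\<close> expresses the inverse by \<open>inv_into\<close>, whose
  values are known to be those of the identity on \<open>Y\<close> alone; both balls and centres lie
  there.\<close>

lemma coarse_map_inv_into_id:
  assumes "ballean B" "Y \<subseteq> supp B"
  shows "coarse_map (finitary_ballean Y) (subballean B Y) (inv_into Y id)"
proof -
  have inv: "inv_into Y id x = x" if "x \<in> Y" for x
    using inv_into_f_f[of id Y x] that by simp
  then have img: "inv_into Y id ` A = id ` A" if "A \<subseteq> Y" for A
    using that by (force intro: image_cong)
  have "\<And>x F. x \<in> Y \<Longrightarrow> F \<in> radii (finitary_ballean Y)
      \<Longrightarrow> ball_at (finitary_ballean Y) x F \<subseteq> Y"
    by (auto simp: finitary_ballean_def)
  then show ?thesis
    using coarse_map_finitary_ballean[OF assms] img inv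
    by (simp add: coarse_map_def finitary_ballean_def subballean_def)
qed

text \<open>The map from the finitary ballean is coarse by the preceding lemma, so what remains is
  coarseness of the identity in the other direction, unfolded.\<close>

lemma subballean_eq_finitary_iff:
  assumes "ballean B" "Y \<subseteq> supp B"
  shows "ballean_eq (subballean B Y) (finitary_ballean Y) \<longleftrightarrow>
    (\<forall>\<beta>\<in>radii B. \<exists>F. finite F \<and> F \<subseteq> Y \<and>
      (\<forall>y\<in>Y. Y \<inter> ball_at B y \<beta> \<subseteq> (if y \<in> F then F else {y})))"
proof -
  have "ballean_eq (subballean B Y) (finitary_ballean Y) \<longleftrightarrow>
      coarse_map (subballean B Y) (finitary_ballean Y) id"
    using coarse_map_inv_into_id[OF assms]
    by (simp add: ballean_eq_def asymorphism_def) (simp add: subballean_def finitary_ballean_def)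
  then show ?thesis
    by (auto simp: coarse_map_def subballean_def finitary_ballean_def conj_commute conj_left_commute)
qed

text \<open>The two records may differ at arguments outside the support or the radii, so they need
  not be equal; coarse maps see only the arguments at which they agree.\<close>

lemma subballean_supp_eq_iff:
  "ballean_eq (subballean B (supp B)) C \<longleftrightarrow> ballean_eq B C" if "ballean B"
proof -
  have ball: "ball_at (subballean B (supp B)) x \<alpha> = ball_at B x \<alpha>"
    if "x \<in> supp B" "\<alpha> \<in> radii B" for x \<alpha>
    using ball_at_subset[OF \<open>ballean B\<close> that] by (auto simp: subballean_def)
  have simps: "supp (subballean B (supp B)) = supp B" "radii (subballean B (supp B)) = radii B"
    by (simp_all add: subballean_def)
  have "coarse_map (subballean B (supp B)) C id \<longleftrightarrow> coarse_map B C id"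
    by (simp add: coarse_map_def simps ball)
  moreover have "coarse_map C (subballean B (supp B)) f \<longleftrightarrow> coarse_map C B f" for f
    unfolding coarse_map_def simps using ball by (smt (verit) image_subset_iff)
  ultimately show ?thesis
    by (simp add: ballean_eq_def asymorphism_def simps)
qed

section \<open>Counting the subsets of \<open>Y\<close> in a hyperball\<close>

lemma finite_if_card_subsets_le:
  assumes "\<And>T. finite T \<Longrightarrow> T \<subseteq> S \<Longrightarrow> card T \<le> n"
  shows "finite S"
proof (rule ccontr)
  assume "infinite S"
  then obtain T where "T \<subseteq> S" "finite T" "card T = Suc n"
    using infinite_arbitrarily_large by blast
  with assms[of T] show False
    by simp
qed

text \<open>Intersecting with \<open>Pow Y\<close> lets one statement serve both the whole support
  and a discrete large set.\<close>

lemma subballean_eq_finitary_if_hyper: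
  assumes B: "ballean B" and Y: "Y \<subseteq> supp B"
    and bound: "\<And>\<beta>. \<beta> \<in> radii B \<Longrightarrow> \<exists>n. \<forall>W\<in>hyper_supp B. W \<subseteq> Y \<longrightarrow>
      finite (ball_at (hyperballean B) W \<beta> \<inter> Pow Y) \<and>
      card (ball_at (hyperballean B) W \<beta> \<inter> Pow Y) \<le> n"
  shows "ballean_eq (subballean B Y) (finitary_ballean Y)"
  unfolding subballean_eq_finitary_iff[OF B Y]
proof
  fix \<beta> assume \<beta>: "\<beta> \<in> radii B"
  obtain n where n: "\<And>W. W \<in> hyper_supp B \<Longrightarrow> W \<subseteq> Y \<Longrightarrow>
      finite (ball_at (hyperballean B) W \<beta> \<inter> Pow Y) \<and>
      card (ball_at (hyperballean B) W \<beta> \<inter> Pow Y) \<le> n"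
    using bound[OF \<beta>] by blast
  have hyper: "A \<in> hyper_supp B" if "finite A" "A \<noteq> {}" "A \<subseteq> Y" for A
    using finite_bounded_in[OF B that(1)] that Y by (auto simp: hyper_supp_def)
  have fin_ball: "finite (Y \<inter> ball_at B y \<beta>)" if y: "y \<in> Y" for y
  proof -
    \<comment> \<open>Points embed as singletons, so the ball around \<open>y\<close> in
      \<open>Y\<close> injects into a hyperball around \<open>{y}\<close>.\<close>
    have "{z} \<in> ball_at (hyperballean B) {y} \<beta> \<inter> Pow Y" if "z \<in> Y \<inter> ball_at B y \<beta>" for z
      using that hyper[of "{z}"] ball_at_commute[OF B \<beta>, of y z] y Y
      by (auto simp: mem_hyper_ball_iff)
    then have "(\<lambda>z. {z}) ` (Y \<inter> ball_at B y \<beta>) \<subseteq> ball_at (hyperballean B) {y} \<beta> \<inter> Pow Y"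
      by blast
    then have "finite ((\<lambda>z. {z}) ` (Y \<inter> ball_at B y \<beta>))"
      using n[of "{y}"] hyper[of "{y}"] y finite_subset by blast
    then show ?thesis
      by (rule finite_imageD) simp
  qed
  \<comment> \<open>These are the centres of nontrivial balls; \<open>n\<close> will bound every
    finite subset of \<open>S\<close>, hence make \<open>S\<close> finite.\<close>
  define S where "S = {y \<in> Y. Y \<inter> ball_at B y \<beta> \<noteq> {y}}"
  have "\<exists>z \<in> Y. z \<in> ball_at B x \<beta> \<and> z \<noteq> x" if "x \<in> S" for x
    using that ball_at_center[OF B _ \<beta>] Y unfolding S_def by blast
  then obtain c where c: "\<And>x. x \<in> S \<Longrightarrow> c x \<in> Y \<and> c x \<in> ball_at B x \<beta> \<and> c x \<noteq> x"
    by metis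
  have "finite S"
  proof (rule finite_if_card_subsets_le)
    fix T assume T: "finite T" "T \<subseteq> S"
    show "card T \<le> n"
    proof (cases "T = {}")
      case False
      \<comment> \<open>Companions may themselves lie in \<open>T\<close>. Still \<open>c x\<close>
        survives in \<open>W - {x}\<close> because it differs from \<open>x\<close>, so this set is
        non-empty and has \<open>x\<close> within \<beta>.\<close>
      define W where "W = T \<union> c ` T"
      have W: "finite W" "W \<subseteq> Y" "W \<noteq> {}"
        using T c False unfolding W_def S_def by auto
      have "W - {x} \<in> ball_at (hyperballean B) W \<beta> \<inter> Pow Y" if x: "x \<in> T" for x
      proof -
        have cx: "c x \<in> W - {x}" "c x \<in> ball_at B x \<beta>" "c x \<in> Y" "x \<in> Y"
          using x T c unfolding W_def S_def by auto
        then have "x \<in> ball_around B (W - {x}) \<beta>"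
          using ball_at_commute[OF B \<beta>, of x "c x"] Y unfolding ball_around_def by blast
        moreover have "W - {x} \<subseteq> ball_around B (W - {x}) \<beta>" "W \<subseteq> ball_around B W \<beta>"
          using W(2) Y by (auto intro!: ball_around_superset[OF B _ \<beta>, THEN subsetD])
        ultimately show ?thesis
          using hyper[of "W - {x}"] W cx(1) by (auto simp: mem_hyper_ball_iff)
      qed
      then have "(\<lambda>x. W - {x}) ` T \<subseteq> ball_at (hyperballean B) W \<beta> \<inter> Pow Y"
        by blast
      moreover have "inj_on (\<lambda>x. W - {x}) T"
        unfolding inj_on_def W_def by blast
      ultimately show ?thesis
        using n[OF hyper[OF W(1,3,2)] W(2)] card_image card_mono le_trans by metis
    qed simp
  qed
  \<comment> \<open>A finite union of finite balls. It contains \<open>S\<close>, since each ball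
    contains its centre.\<close>
  define F where "F = (\<Union>x\<in>S. Y \<inter> ball_at B x \<beta>)"
  have "finite F"
    using \<open>finite S\<close> fin_ball unfolding F_def S_def by blast
  moreover have "Y \<inter> ball_at B y \<beta> \<subseteq> (if y \<in> F then F else {y})" if y: "y \<in> Y" for y
  proof (cases "y \<in> S")
    case True
    then have "Y \<inter> ball_at B y \<beta> \<subseteq> F"
      unfolding F_def by blast
    moreover have "y \<in> ball_at B y \<beta>"
      using ball_at_center[OF B _ \<beta>] y Y by blast
    ultimately show ?thesis
      using y by auto
  next
    case False
    then show ?thesis
      using y by (auto simp: S_def)
  qed
  ultimately show "\<exists>F. finite F \<and> F \<subseteq> Y \<and>
      (\<forall>y\<in>Y. Y \<inter> ball_at B y \<beta> \<subseteq> (if y \<in> F then F else {y}))"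
    unfolding F_def by blast
qed

text \<open>A member \<open>Z\<close> of the hyperball agrees with \<open>W\<close> outside
  \<open>F\<close>, so \<open>Z \<inter> F\<close> determines it; the resulting bound
  \<open>card (Pow F)\<close> does not depend on \<open>W\<close>.\<close>

lemma hyper_bound_if_subballean_eq_finitary:
  assumes B: "ballean B" and Y: "Y \<subseteq> supp B" and \<beta>: "\<beta> \<in> radii B"
    and eq: "ballean_eq (subballean B Y) (finitary_ballean Y)"
  shows "\<exists>n. \<forall>W\<in>hyper_supp B. W \<subseteq> Y \<longrightarrow>
      finite (ball_at (hyperballean B) W \<beta> \<inter> Pow Y) \<and>
      card (ball_at (hyperballean B) W \<beta> \<inter> Pow Y) \<le> n"
proof -
  obtain F where F: "finite F" "F \<subseteq> Y"
    "\<And>y. y \<in> Y \<Longrightarrow> Y \<inter> ball_at B y \<beta> \<subseteq> (if y \<in> F then F else {y})"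
    using eq[unfolded subballean_eq_finitary_iff[OF B Y], rule_format, OF \<beta>] by metis
  have around: "Y \<inter> ball_around B A \<beta> \<subseteq> A \<union> F" if "A \<subseteq> Y" for A
  proof
    fix y assume "y \<in> Y \<inter> ball_around B A \<beta>"
    then obtain a where a: "a \<in> A" "y \<in> Y \<inter> ball_at B a \<beta>"
      by (auto simp: ball_around_def)
    then show "y \<in> A \<union> F"
      using F(3)[of a] that by (cases "a \<in> F") auto
  qed
  have "finite (ball_at (hyperballean B) W \<beta> \<inter> Pow Y) \<and>
      card (ball_at (hyperballean B) W \<beta> \<inter> Pow Y) \<le> card (Pow F)"
    if W: "W \<subseteq> Y" for W
  proof -
    let ?H = "ball_at (hyperballean B) W \<beta> \<inter> Pow Y"
    have "Z - F = W - F" if "Z \<in> ?H" for Z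
    proof -
      have "Z \<subseteq> W \<union> F" "W \<subseteq> Z \<union> F"
        using that around[OF W] around[of Z] W by (auto simp: mem_hyper_ball_iff)
      then show ?thesis
        by blast
    qed
    then have "inj_on (\<lambda>Z. Z \<inter> F) ?H"
      by (intro inj_onI) (metis Int_Diff_Un)
    moreover have "(\<lambda>Z. Z \<inter> F) ` ?H \<subseteq> Pow F"
      by blast
    ultimately show ?thesis
      using F(1) card_inj_on_le[of _ ?H "Pow F"] inj_on_finite[of _ ?H "Pow F"] by blast
  qed
  then show ?thesis
    by blast
qed

section \<open>Discrete sets and bounded geometry of the hyperballean\<close>

text \<open>A subset of \<open>Y\<close> is recovered as the trace on \<open>Y\<close> of its
  \<alpha>-neighbourhood, so two such subsets within \<alpha> of each other include one
  another.\<close>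

lemma discrete_in_hyperballean:
  assumes B: "ballean B" and \<alpha>: "\<alpha> \<in> radii B" and Y: "discrete_in B \<alpha> Y"
    and S: "S \<subseteq> hyper_supp B" "S \<subseteq> Pow Y"
  shows "discrete_in (hyperballean B) \<alpha> S"
proof -
  have "ball_at B z \<alpha> \<inter> Y = {z}" if "z \<in> Y" for z
    using Y that by (simp add: discrete_in_def)
  then have around: "Y \<inter> ball_around B Z \<alpha> = Z" if "Z \<subseteq> Y" for Z
    using that unfolding ball_around_def Int_UN_distrib by (simp add: Int_commute subset_iff)
  have "ball_at (hyperballean B) Z \<alpha> \<inter> S = {Z}" if Z: "Z \<in> S" for Z
  proof -
    have "Z' = Z" if "Z' \<in> S" "Z' \<subseteq> ball_around B Z \<alpha>" "Z \<subseteq> ball_around B Z' \<alpha>" for Z'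
      using around[of Z] around[of Z'] that Z S(2) by blast
    moreover have "Z \<subseteq> ball_around B Z \<alpha>"
      using around[of Z] Z S(2) by blast
    ultimately show ?thesis
      using Z S(1) unfolding set_eq_iff Int_iff mem_hyper_ball_iff by blast
  qed
  then show ?thesis
    using S(1) by (simp add: discrete_in_def)
qed

text \<open>Zorn's lemma gives a maximal \<alpha>-discrete set; by symmetry of balls, a point
  outside its \<alpha>-neighbourhood could be added to it.\<close>

lemma ex_large_discrete:
  assumes B: "ballean B" and \<alpha>: "\<alpha> \<in> radii B"
  shows "\<exists>Y. discrete_in B \<alpha> Y \<and> large_in B Y"
proof -
  have "\<exists>M\<in>{Y. discrete_in B \<alpha> Y}. \<forall>Y\<in>{Y. discrete_in B \<alpha> Y}. M \<subseteq> Y \<longrightarrow> Y = M"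
  proof (rule subset_Zorn)
    fix C assume C: "subset.chain {Y. discrete_in B \<alpha> Y} C"
    have "ball_at B x \<alpha> \<inter> \<Union>C = {x}" if x: "x \<in> \<Union>C" for x
    proof -
      obtain X where X: "X \<in> C" "x \<in> X"
        using x by blast
      \<comment> \<open>The larger of the two chain members contains both points and is
        discrete.\<close>
      have "z = x" if z: "z \<in> Z" "Z \<in> C" "z \<in> ball_at B x \<alpha>" for z Z
      proof -
        have "X \<subseteq> Z \<or> Z \<subseteq> X"
          using subset.chain_total[OF C X(1) z(2)] by blast
        moreover have "discrete_in B \<alpha> X" "discrete_in B \<alpha> Z"
          using C X z unfolding subset.chain_def by auto
        ultimately show ?thesis
          using X z unfolding discrete_in_def by blast
      qed
      moreover have "x \<in> ball_at B x \<alpha>"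
        using C X unfolding subset.chain_def discrete_in_def by blast
      ultimately show ?thesis
        using X by blast
    qed
    moreover have "\<Union>C \<subseteq> supp B"
      using C unfolding subset.chain_def discrete_in_def by blast
    ultimately have "discrete_in B \<alpha> (\<Union>C)"
      by (simp add: discrete_in_def)
    then show "\<exists>U\<in>{Y. discrete_in B \<alpha> Y}. \<forall>X\<in>C. X \<subseteq> U"
      by blast
  qed
  then obtain Y where Y: "discrete_in B \<alpha> Y"
    and max: "\<And>Z. discrete_in B \<alpha> Z \<Longrightarrow> Y \<subseteq> Z \<Longrightarrow> Z = Y"
    by blast
  have sub: "Y \<subseteq> supp B"
    using Y by (simp add: discrete_in_def)
  have "x \<in> ball_around B Y \<alpha>" if x: "x \<in> supp B" for x
  proof (rule ccontr)
    assume far: "x \<notin> ball_around B Y \<alpha>"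
    have "x \<notin> Y"
      using far ball_around_superset[OF B sub \<alpha>] by blast
    have "y \<notin> ball_at B x \<alpha>" "x \<notin> ball_at B y \<alpha>" if "y \<in> Y" for y
      using far that ball_at_commute[OF B \<alpha> x, of y] sub unfolding ball_around_def by blast+
    then have "discrete_in B \<alpha> (insert x Y)"
      using Y x ball_at_center[OF B x \<alpha>] unfolding discrete_in_def by blast
    then show False
      using max[of "insert x Y"] \<open>x \<notin> Y\<close> by blast
  qed
  then have "large_in B Y"
    using sub \<alpha> ball_around_subset[OF B sub \<alpha>] unfolding large_in_def by blast
  with Y show ?thesis
    by blast
qed

text \<open>Conversely to the use of a maximal discrete set, a large \<open>Y\<close> allows bounded
  sets to be rounded to subsets of \<open>Y\<close>. Rounding is injective on sufficiently discrete
  families and sends hyperballs into hyperballs of a larger radius, where the count is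
  known.\<close>

lemma bounded_geometry_hyperballean_iff:
  assumes B: "ballean B"
  shows "bounded_geometry (hyperballean B) \<longleftrightarrow>
    (\<exists>Y. large_in B Y \<and> ballean_eq (subballean B Y) (finitary_ballean Y))" (is "?L \<longleftrightarrow> ?R")
proof
  assume ?L
  then obtain \<alpha> and f :: "'b \<Rightarrow> nat" where \<alpha>: "\<alpha> \<in> radii B" and
    f: "\<And>W \<beta> S. W \<in> hyper_supp B \<Longrightarrow> \<beta> \<in> radii B \<Longrightarrow> discrete_in (hyperballean B) \<alpha> S \<Longrightarrow>
      S \<subseteq> ball_at (hyperballean B) W \<beta> \<Longrightarrow> finite S \<and> card S \<le> f \<beta>"
    unfolding bounded_geometry_def hyperballean_simps by metis
  obtain Y where Y: "discrete_in B \<alpha> Y" "large_in B Y"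
    using ex_large_discrete[OF B \<alpha>] by blast
  \<comment> \<open>The part of a hyperball inside \<open>Pow Y\<close> is thus an admissible
    family, of size at most \<open>f \<beta>\<close> for every centre.\<close>
  have "discrete_in (hyperballean B) \<alpha> (ball_at (hyperballean B) W \<beta> \<inter> Pow Y)" for W \<beta>
    by (rule discrete_in_hyperballean[OF B \<alpha> Y(1)]) (auto simp: mem_hyper_ball_iff)
  then have "ballean_eq (subballean B Y) (finitary_ballean Y)"
    using Y(1) f by (intro subballean_eq_finitary_if_hyper[OF B]) (simp add: discrete_in_def, metis Int_lower1)
  with Y(2) show ?R
    by blast
next
  assume ?R
  then obtain Y \<delta> where Y: "Y \<subseteq> supp B" and \<delta>: "\<delta> \<in> radii B" "supp B = ball_around B Y \<delta>"
    and eq: "ballean_eq (subballean B Y) (finitary_ballean Y)"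
    unfolding large_in_def by blast
  \<comment> \<open>The rounding map: largeness of \<open>Y\<close> with radius \<delta> puts
    \<open>A\<close> and \<open>g A\<close> within \<delta> of each other.\<close>
  define g where "g A = Y \<inter> ball_around B A \<delta>" for A
  have g_around: "A \<subseteq> ball_around B (g A) \<delta>" if A: "A \<subseteq> supp B" for A
  proof
    fix a assume a: "a \<in> A"
    then obtain y where y: "y \<in> Y" "a \<in> ball_at B y \<delta>"
      using A \<delta>(2) unfolding ball_around_def by blast
    then have "y \<in> g A"
      using a A Y ball_at_commute[OF B \<delta>(1), of y a] unfolding g_def ball_around_def by blast
    with y show "a \<in> ball_around B (g A) \<delta>"
      unfolding ball_around_def by blast
  qed
  have g_sub: "g A \<subseteq> Y" "g A \<subseteq> ball_around B A \<delta>" for A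
    by (auto simp: g_def)
  have hyper_sub: "A \<subseteq> supp B" if "A \<in> hyper_supp B" for A
    using that by (auto simp: hyper_supp_def bounded_in_def)
  have g_hyper: "g A \<in> hyper_supp B" if A: "A \<in> hyper_supp B" for A
  proof -
    have "g A \<noteq> {}"
      using g_around[OF hyper_sub[OF A]] A by (auto simp: hyper_supp_def ball_around_def)
    then show ?thesis
      using bounded_in_subset[OF bounded_in_ball_around[OF B _ \<delta>(1)] g_sub(2)] A
      by (auto simp: hyper_supp_def)
  qed
  \<comment> \<open>Sets with the same rounding are two \<delta>-steps apart, which \<alpha>
    absorbs. It depends on \<delta> alone, as bounded geometry fixes \<alpha> before
    \<beta>.\<close>
  obtain \<alpha> where \<alpha>: "\<alpha> \<in> radii B"
    "\<And>A. A \<subseteq> supp B \<Longrightarrow> ball_around B (ball_around B A \<delta>) \<delta> \<subseteq> ball_around B A \<alpha>"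
    using ballean_compose B \<delta>(1) by metis
  have "\<exists>n. \<forall>W\<in>hyper_supp B. \<forall>S. discrete_in (hyperballean B) \<alpha> S \<and>
      S \<subseteq> ball_at (hyperballean B) W \<beta> \<longrightarrow> finite S \<and> card S \<le> n"
    if \<beta>: "\<beta> \<in> radii B" for \<beta>
  proof -
    \<comment> \<open>The path from \<open>g W\<close> to \<open>g Z\<close> takes steps \<delta> to
      \<open>W\<close>, \<beta> to \<open>Z\<close> and \<delta> to \<open>g Z\<close>;
      \<open>\<beta>'\<close> absorbs the first two and \<gamma> all three.\<close>
    obtain \<beta>' where \<beta>': "\<beta>' \<in> radii B"
      "\<And>A. A \<subseteq> supp B \<Longrightarrow> ball_around B (ball_around B A \<delta>) \<beta> \<subseteq> ball_around B A \<beta>'"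
      using ballean_compose B \<delta>(1) \<beta> by metis
    obtain \<gamma> where \<gamma>: "\<gamma> \<in> radii B"
      "\<And>A. A \<subseteq> supp B \<Longrightarrow> ball_around B (ball_around B A \<beta>') \<delta> \<subseteq> ball_around B A \<gamma>"
      using ballean_compose B \<delta>(1) \<beta>'(1) by metis
    obtain n where n: "\<And>W. W \<in> hyper_supp B \<Longrightarrow> W \<subseteq> Y \<Longrightarrow>
        finite (ball_at (hyperballean B) W \<gamma> \<inter> Pow Y) \<and>
        card (ball_at (hyperballean B) W \<gamma> \<inter> Pow Y) \<le> n"
      using hyper_bound_if_subballean_eq_finitary[OF B Y \<gamma>(1) eq] by blast
    \<comment> \<open>One inclusion of the hyperball condition; exchanging \<open>Z\<close> and
      \<open>W\<close> gives the other.\<close>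
    have g_near: "g Z \<subseteq> ball_around B (g W) \<gamma>"
      if "Z \<subseteq> ball_around B W \<beta>" "W \<in> hyper_supp B" for Z W
    proof -
      have gW: "g W \<subseteq> supp B"
        using g_sub(1) Y by blast
      have "Z \<subseteq> ball_around B (ball_around B (g W) \<delta>) \<beta>"
        using that(1) ball_around_mono[OF g_around[OF hyper_sub[OF that(2)]]] by (rule order_trans)
      then have "Z \<subseteq> ball_around B (g W) \<beta>'"
        using \<beta>'(2)[OF gW] by (rule order_trans)
      then have "ball_around B Z \<delta> \<subseteq> ball_around B (ball_around B (g W) \<beta>') \<delta>"
        by (rule ball_around_mono)
      then show ?thesis
        using g_sub(2)[of Z] \<gamma>(2)[OF gW] by (meson order_trans)
    qed
    have "finite S \<and> card S \<le> n"
      if W: "W \<in> hyper_supp B" and disc: "discrete_in (hyperballean B) \<alpha> S"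
        and S: "S \<subseteq> ball_at (hyperballean B) W \<beta>" for W S
    proof -
      have SH: "S \<subseteq> hyper_supp B"
        using disc by (simp add: discrete_in_def)
      have near: "Z \<subseteq> ball_around B Z' \<alpha>"
        if "Z \<in> S" "Z' \<in> S" "g Z = g Z'" for Z Z'
      proof -
        have "Z \<subseteq> ball_around B (g Z') \<delta>"
          using g_around[OF hyper_sub[of Z]] SH that(1) by (auto simp flip: that(3))
        also have "\<dots> \<subseteq> ball_around B (ball_around B Z' \<delta>) \<delta>"
          by (rule ball_around_mono[OF g_sub(2)])
        also have "\<dots> \<subseteq> ball_around B Z' \<alpha>"
          using that(2) SH by (intro \<alpha>(2) hyper_sub) (rule subsetD)
        finally show ?thesis .
      qed
      \<comment> \<open>Equal roundings put two members within \<alpha>, and discreteness identifies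
        them.\<close>
      have "inj_on g S"
      proof (rule inj_onI)
        fix Z Z' assume Z: "Z \<in> S" "Z' \<in> S" "g Z = g Z'"
        then have "Z' \<in> ball_at (hyperballean B) Z \<alpha> \<inter> S"
          using near[of Z Z'] near[of Z' Z] SH by (auto simp: mem_hyper_ball_iff)
        then show "Z = Z'"
          using disc Z(1) unfolding discrete_in_def by blast
      qed
      moreover have "g Z \<in> ball_at (hyperballean B) (g W) \<gamma> \<inter> Pow Y" if "Z \<in> S" for Z
      proof -
        have "Z \<in> hyper_supp B" "Z \<subseteq> ball_around B W \<beta>" "W \<subseteq> ball_around B Z \<beta>"
          using subsetD[OF S that] by (simp_all add: mem_hyper_ball_iff)
        then show ?thesis
          using W g_near g_hyper g_sub(1) by (simp add: mem_hyper_ball_iff)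
      qed
      then have "g ` S \<subseteq> ball_at (hyperballean B) (g W) \<gamma> \<inter> Pow Y"
        by blast
      ultimately show ?thesis
        using n[OF g_hyper[OF W] g_sub(1)] card_inj_on_le[of g S] inj_on_finite[of g S] le_trans
        by metis
    qed
    then show ?thesis
      by blast
  qed
  then obtain f where "\<And>\<beta>. \<beta> \<in> radii B \<Longrightarrow> \<forall>W\<in>hyper_supp B. \<forall>S.
      discrete_in (hyperballean B) \<alpha> S \<and> S \<subseteq> ball_at (hyperballean B) W \<beta> \<longrightarrow>
      finite S \<and> card S \<le> f \<beta>"
    by metis
  then show ?L
    unfolding bounded_geometry_def hyperballean_simps using \<alpha>(1) by blast
qed

text \<open>This is the counting result for \<open>Y = supp B\<close>, where intersecting with
  \<open>Pow Y\<close> changes nothing.\<close>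

lemma uniformly_locally_finite_hyperballean_iff:
  assumes B: "ballean B"
  shows "uniformly_locally_finite (hyperballean B) \<longleftrightarrow>
    ballean_eq B (finitary_ballean (supp B))"
proof -
  have "ball_at (hyperballean B) W \<beta> \<inter> Pow (supp B) = ball_at (hyperballean B) W \<beta>" for W \<beta>
    by (auto simp: mem_hyper_ball_iff hyper_supp_def bounded_in_def)
  moreover have "W \<subseteq> supp B" if "W \<in> hyper_supp B" for W
    using that by (auto simp: hyper_supp_def bounded_in_def)
  ultimately have "uniformly_locally_finite (hyperballean B) \<longleftrightarrow>
      ballean_eq (subballean B (supp B)) (finitary_ballean (supp B))"
    using subballean_eq_finitary_if_hyper[OF B order_refl]
      hyper_bound_if_subballean_eq_finitary[OF B order_refl]
    unfolding uniformly_locally_finite_def hyperballean_simps by (smt (verit))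
  then show ?thesis
    by (simp add: subballean_supp_eq_iff[OF B])
qed

theorem theorem2p1:
  fixes B :: "('x, 'p) ball_struct"
  assumes "ballean B" and "\<not> bounded_ballean B"
  shows "(uniformly_locally_finite (hyperballean B) \<longleftrightarrow>
            ballean_eq B (finitary_ballean (supp B))) \<and>
         (bounded_geometry (hyperballean B) \<longleftrightarrow>
            (\<exists>Y. large_in B Y \<and> ballean_eq (subballean B Y) (finitary_ballean Y)))"
  using uniformly_locally_finite_hyperballean_iff[OF assms(1)]
    bounded_geometry_hyperballean_iff[OF assms(1)] by blast

end
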